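(* Let $\mathcal{A}$ be a unital $*$-algebra over $\mathbb{C}$, let $(M,h)$ be a right hermitian $\mathcal{A}$-module with generators $\{e_a\}_{a=1}^n$, and set $h_{ab}=h(e_a,e_b)$. Then $(M,h)$ is a regular hermitian module if and only if there exist $h^{ab}\in\mathcal{A}$ (for $a,b=1,\ldots,n$) such that $(h^{ab})^*=h^{ba}$ for all $a,b=1,\ldots,n$ and $$\sum_{r,s=1}^n e_r h^{rs}h_{sc}=e_c\qquad\text{for } c=1,\ldots,n.$$
   Context: A hermitian form on a right $\mathcal{A}$-module $M$ is a map $h:M\times M\to\mathcal{A}$ with $h(m_1,m_2)^*=h(m_2,m_1)$, $h(m_1,m_2a)=h(m_1,m_2)a$ and $h(m_1+m_2,m)=h(m_1,m)+h(m_2,m)$ for all $m,m_1,m_2\in M$, $a\in\mathcal{A}$. A right hermitian $\mathcal{A}$-module is a pair $(M,h)$ of a right $\mathcal{A}$-module $M$ and a hermitian form $h$ on $M$. Let $M^*$ be the dual module of right $\mathcal{A}$-module homomorphisms $M\to\mathcal{A}$, and let $\hat h:M\to M^*$ be given by $\hat h(m_1)(m_2)=h(m_1,m_2)$. The form $h$ is called invertible if $\hat h$ is a bijection. $(M,h)$ is called a regular hermitian module if $M$ is a finitely generated projective module and $h$ is invertible. *)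

theory Defs
  imports "HOL-Algebra.Module" "HOL-Algebra.Algebraic_Closure_Type"
begin

section \<open>Unital star-algebras over the complex numbers\<close>

record 'a star_algebra = "(complex, 'a) module" +
  star :: "'a \<Rightarrow> 'a"

text \<open>
  The library locale \<^locale>\<open>algebra\<close> is restricted to commutative algebras, so the
  compatibility of the scalar action with the product is stated here. The zero algebra is allowed.
\<close>

locale unital_star_algebra =
  A?: ring A + C?: module "ring_of_type_algebra :: complex ring" A
  for A :: "'a star_algebra" (structure) +
  assumes scale_mult_left:
      "\<lbrakk>x \<in> carrier A; y \<in> carrier A\<rbrakk> \<Longrightarrow> (c \<odot> x) \<otimes> y = c \<odot> (x \<otimes> y)"
    and scale_mult_right:
      "\<lbrakk>x \<in> carrier A; y \<in> carrier A\<rbrakk> \<Longrightarrow> x \<otimes> (c \<odot> y) = c \<odot> (x \<otimes> y)"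
    and star_closed [simp, intro]: "x \<in> carrier A \<Longrightarrow> star A x \<in> carrier A"
    and star_star [simp]: "x \<in> carrier A \<Longrightarrow> star A (star A x) = x"
    and star_add: "\<lbrakk>x \<in> carrier A; y \<in> carrier A\<rbrakk> \<Longrightarrow> star A (x \<oplus> y) = star A x \<oplus> star A y"
    and star_scale: "x \<in> carrier A \<Longrightarrow> star A (c \<odot> x) = cnj c \<odot> star A x"
    and star_mult: "\<lbrakk>x \<in> carrier A; y \<in> carrier A\<rbrakk> \<Longrightarrow> star A (x \<otimes> y) = star A y \<otimes> star A x"


section \<open>Right modules over a not necessarily commutative ring\<close>

text \<open>
  As in the library record \<^type>\<open>module\<close>, only the additive part of the underlying ring
  record is used.
\<close>

record ('a, 'm) rmodule = "'m ring" +
  ract :: "'m \<Rightarrow> 'a \<Rightarrow> 'm" (infixl \<open>\<triangleleft>\<index>\<close> 70)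

locale right_module = R?: ring R + M?: abelian_group M
  for R :: "('a, 'r) ring_scheme" (structure) and M :: "('a, 'm) rmodule" (structure) +
  assumes ract_closed [simp, intro]:
      "\<lbrakk>x \<in> carrier M; a \<in> carrier R\<rbrakk> \<Longrightarrow> x \<triangleleft>\<^bsub>M\<^esub> a \<in> carrier M"
    and ract_add_left:
      "\<lbrakk>x \<in> carrier M; y \<in> carrier M; a \<in> carrier R\<rbrakk>
        \<Longrightarrow> (x \<oplus>\<^bsub>M\<^esub> y) \<triangleleft>\<^bsub>M\<^esub> a = x \<triangleleft>\<^bsub>M\<^esub> a \<oplus>\<^bsub>M\<^esub> y \<triangleleft>\<^bsub>M\<^esub> a"
    and ract_add_right:
      "\<lbrakk>x \<in> carrier M; a \<in> carrier R; b \<in> carrier R\<rbrakk>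
        \<Longrightarrow> x \<triangleleft>\<^bsub>M\<^esub> (a \<oplus> b) = x \<triangleleft>\<^bsub>M\<^esub> a \<oplus>\<^bsub>M\<^esub> x \<triangleleft>\<^bsub>M\<^esub> b"
    and ract_mult:
      "\<lbrakk>x \<in> carrier M; a \<in> carrier R; b \<in> carrier R\<rbrakk>
        \<Longrightarrow> x \<triangleleft>\<^bsub>M\<^esub> (a \<otimes> b) = (x \<triangleleft>\<^bsub>M\<^esub> a) \<triangleleft>\<^bsub>M\<^esub> b"
    and ract_one [simp]: "x \<in> carrier M \<Longrightarrow> x \<triangleleft>\<^bsub>M\<^esub> \<one> = x"

definition rmod_hom ::
    "('a, 'r) ring_scheme \<Rightarrow> ('a, 'm) rmodule \<Rightarrow> ('a, 'n) rmodule \<Rightarrow> ('m \<Rightarrow> 'n) set" where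
  "rmod_hom R M N = {f \<in> carrier M \<rightarrow> carrier N.
     (\<forall>x\<in>carrier M. \<forall>y\<in>carrier M. f (x \<oplus>\<^bsub>M\<^esub> y) = f x \<oplus>\<^bsub>N\<^esub> f y) \<and>
     (\<forall>x\<in>carrier M. \<forall>a\<in>carrier R. f (x \<triangleleft>\<^bsub>M\<^esub> a) = f x \<triangleleft>\<^bsub>N\<^esub> a)}"

definition self_rmodule :: "('a, 'r) ring_scheme \<Rightarrow> ('a, 'a) rmodule" where
  "self_rmodule R = \<lparr>carrier = carrier R, monoid.mult = monoid.mult R, one = one R,
     zero = zero R, add = add R, ract = monoid.mult R\<rparr>"

text \<open>
  Elements of the dual module are extended by \<^const>\<open>undefined\<close> outside the carrier, so that
  equality in the set is equality of maps on the module.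
\<close>

definition rmod_dual :: "('a, 'r) ring_scheme \<Rightarrow> ('a, 'm) rmodule \<Rightarrow> ('m \<Rightarrow> 'a) set" where
  "rmod_dual R M = rmod_hom R M (self_rmodule R) \<inter> extensional (carrier M)"

definition generates ::
    "('a, 'r) ring_scheme \<Rightarrow> ('a, 'm) rmodule \<Rightarrow> nat \<Rightarrow> (nat \<Rightarrow> 'm) \<Rightarrow> bool" where
  "generates R M n e \<longleftrightarrow> e \<in> {1..n} \<rightarrow> carrier M \<and>
     (\<forall>x\<in>carrier M. \<exists>c \<in> {1..n} \<rightarrow> carrier R. x = (\<Oplus>\<^bsub>M\<^esub>i\<in>{1..n}. e i \<triangleleft>\<^bsub>M\<^esub> c i))"

definition finitely_generated :: "('a, 'r) ring_scheme \<Rightarrow> ('a, 'm) rmodule \<Rightarrow> bool" where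
  "finitely_generated R M \<longleftrightarrow> (\<exists>n e. generates R M n e)"

text \<open>
  Projectivity is the lifting property against surjective homomorphisms \<open>f : N \<rightarrow> L\<close>. HOL cannot
  quantify over the types carrying \<open>N\<close> and \<open>L\<close>; they are fixed to types large enough for
  the free module on the elements of \<open>M\<close>, and for \<open>M\<close> itself. Lemma \<open>projective_lift\<close> below
  shows that the lifting property then holds for modules \<open>N\<close> and \<open>L\<close> over arbitrary types.
\<close>

definition projective :: "('a, 'r) ring_scheme \<Rightarrow> ('a, 'm) rmodule \<Rightarrow> bool" where
  "projective R M \<longleftrightarrow>
     (\<forall>(N :: ('a, 'm \<Rightarrow> 'a) rmodule) (L :: ('a, 'm) rmodule) f g.
        right_module R N \<longrightarrow> right_module R L \<longrightarrow>
        f \<in> rmod_hom R N L \<longrightarrow> f ` carrier N = carrier L \<longrightarrow> g \<in> rmod_hom R M L \<longrightarrow>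
        (\<exists>k \<in> rmod_hom R M N. \<forall>x\<in>carrier M. f (k x) = g x))"


section \<open>Hermitian modules\<close>

locale right_hermitian_module = A?: unital_star_algebra A + M?: right_module A M
  for A :: "'a star_algebra" (structure) and M :: "('a, 'm) rmodule" (structure) +
  fixes h :: "'m \<Rightarrow> 'm \<Rightarrow> 'a"
  assumes form_closed [simp, intro]:
      "\<lbrakk>x \<in> carrier M; y \<in> carrier M\<rbrakk> \<Longrightarrow> h x y \<in> carrier A"
    and form_star: "\<lbrakk>x \<in> carrier M; y \<in> carrier M\<rbrakk> \<Longrightarrow> star A (h x y) = h y x"
    and form_ract: "\<lbrakk>x \<in> carrier M; y \<in> carrier M; a \<in> carrier A\<rbrakk>
      \<Longrightarrow> h x (y \<triangleleft>\<^bsub>M\<^esub> a) = h x y \<otimes> a"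
    and form_add: "\<lbrakk>x \<in> carrier M; y \<in> carrier M; z \<in> carrier M\<rbrakk>
      \<Longrightarrow> h (x \<oplus>\<^bsub>M\<^esub> y) z = h x z \<oplus> h y z"

definition form_hat :: "('a, 'm) rmodule \<Rightarrow> ('m \<Rightarrow> 'm \<Rightarrow> 'a) \<Rightarrow> 'm \<Rightarrow> 'm \<Rightarrow> 'a" where
  "form_hat M h x = (\<lambda>y\<in>carrier M. h x y)"

definition invertible_form ::
    "('a, 'r) ring_scheme \<Rightarrow> ('a, 'm) rmodule \<Rightarrow> ('m \<Rightarrow> 'm \<Rightarrow> 'a) \<Rightarrow> bool" where
  "invertible_form R M h \<longleftrightarrow> bij_betw (form_hat M h) (carrier M) (rmod_dual R M)"

definition regular_hermitian_module ::
    "'a star_algebra \<Rightarrow> ('a, 'm) rmodule \<Rightarrow> ('m \<Rightarrow> 'm \<Rightarrow> 'a) \<Rightarrow> bool" where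
  "regular_hermitian_module A M h \<longleftrightarrow>
     right_hermitian_module A M h \<and> finitely_generated A M \<and> projective A M \<and>
     invertible_form A M h"


section \<open>Projectivity does not depend on the choice of types\<close>

context right_module
begin

lemma ract_zero_right [simp]:
  assumes "x \<in> carrier M" shows "x \<triangleleft>\<^bsub>M\<^esub> \<zero>\<^bsub>R\<^esub> = \<zero>\<^bsub>M\<^esub>"
proof -
  have "x \<triangleleft>\<^bsub>M\<^esub> \<zero> \<oplus>\<^bsub>M\<^esub> x \<triangleleft>\<^bsub>M\<^esub> \<zero> = x \<triangleleft>\<^bsub>M\<^esub> \<zero>"
    using ract_add_right[of x \<zero> \<zero>] assms by simp
  then show ?thesis using assms by (metis M.add.r_cancel_one R.zero_closed ract_closed)
qed

lemma ract_zero_left [simp]: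
  assumes "a \<in> carrier R" shows "\<zero>\<^bsub>M\<^esub> \<triangleleft>\<^bsub>M\<^esub> a = \<zero>\<^bsub>M\<^esub>"
proof -
  have "\<zero>\<^bsub>M\<^esub> \<triangleleft>\<^bsub>M\<^esub> a \<oplus>\<^bsub>M\<^esub> \<zero>\<^bsub>M\<^esub> \<triangleleft>\<^bsub>M\<^esub> a = \<zero>\<^bsub>M\<^esub> \<triangleleft>\<^bsub>M\<^esub> a"
    using ract_add_left[of "\<zero>\<^bsub>M\<^esub>" "\<zero>\<^bsub>M\<^esub>" a] assms by simp
  then show ?thesis using assms by (metis M.add.r_cancel_one M.zero_closed ract_closed)
qed

lemma finsum_ract:
  assumes "finite S" "t \<in> S \<rightarrow> carrier M" "a \<in> carrier R"
  shows "(\<Oplus>\<^bsub>M\<^esub>i\<in>S. t i) \<triangleleft>\<^bsub>M\<^esub> a = (\<Oplus>\<^bsub>M\<^esub>i\<in>S. t i \<triangleleft>\<^bsub>M\<^esub> a)"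
  using assms
proof (induction S rule: finite_induct)
  case (insert i S)
  then have "t \<in> S \<rightarrow> carrier M" "t i \<in> carrier M" "(\<lambda>i. t i \<triangleleft>\<^bsub>M\<^esub> a) \<in> S \<rightarrow> carrier M"
    by auto
  with insert show ?case by (simp add: ract_add_left)
qed simp

end

lemma rmod_homD:
  assumes "f \<in> rmod_hom R M N"
  shows "x \<in> carrier M \<Longrightarrow> f x \<in> carrier N"
    and "x \<in> carrier M \<Longrightarrow> y \<in> carrier M \<Longrightarrow> f (x \<oplus>\<^bsub>M\<^esub> y) = f x \<oplus>\<^bsub>N\<^esub> f y"
    and "x \<in> carrier M \<Longrightarrow> a \<in> carrier R \<Longrightarrow> f (x \<triangleleft>\<^bsub>M\<^esub> a) = f x \<triangleleft>\<^bsub>N\<^esub> a"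
  using assms by (auto simp: rmod_hom_def)

lemma rmod_hom_comp:
  assumes "f \<in> rmod_hom R M N" "g \<in> rmod_hom R N P"
  shows "(\<lambda>x. g (f x)) \<in> rmod_hom R M P"
  using assms by (auto simp: rmod_hom_def Pi_iff)

lemma rmod_hom_zero:
  assumes "right_module R M" "right_module R N" "f \<in> rmod_hom R M N"
  shows "f \<zero>\<^bsub>M\<^esub> = \<zero>\<^bsub>N\<^esub>"
proof -
  interpret M: right_module R M by fact
  interpret N: right_module R N by fact
  have "f \<zero>\<^bsub>M\<^esub> \<oplus>\<^bsub>N\<^esub> f \<zero>\<^bsub>M\<^esub> = f \<zero>\<^bsub>M\<^esub>"
    using rmod_homD(2)[OF assms(3), of "\<zero>\<^bsub>M\<^esub>" "\<zero>\<^bsub>M\<^esub>"] by simp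
  then show ?thesis
    using rmod_homD(1)[OF assms(3), of "\<zero>\<^bsub>M\<^esub>"]
    by (metis N.M.add.r_cancel_one M.M.zero_closed)
qed

lemma rmod_hom_finsum:
  assumes "right_module R M" "right_module R N" "f \<in> rmod_hom R M N"
    and "finite S" "t \<in> S \<rightarrow> carrier M"
  shows "f (\<Oplus>\<^bsub>M\<^esub>i\<in>S. t i) = (\<Oplus>\<^bsub>N\<^esub>i\<in>S. f (t i))"
  using assms(4,5)
proof (induction S rule: finite_induct)
  interpret M: right_module R M by fact
  interpret N: right_module R N by fact
  {
    case empty
    show ?case using rmod_hom_zero[OF assms(1-3)] by simp
  next
    case (insert i S)
    then have "t \<in> S \<rightarrow> carrier M" "t i \<in> carrier M" "(\<lambda>i. f (t i)) \<in> S \<rightarrow> carrier N"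
      "f (t i) \<in> carrier N"
      using rmod_homD(1)[OF assms(3)] by auto
    with insert show ?case by (simp add: rmod_homD(2)[OF assms(3)])
  }
qed

definition free_rmodule :: "('a, 'r) ring_scheme \<Rightarrow> 'x set \<Rightarrow> ('a, 'x \<Rightarrow> 'a) rmodule" where
  "free_rmodule R B = \<lparr>carrier = {c. range c \<subseteq> carrier R \<and> finite {x. c x \<noteq> \<zero>\<^bsub>R\<^esub>} \<and>
       {x. c x \<noteq> \<zero>\<^bsub>R\<^esub>} \<subseteq> B},
     monoid.mult = (\<lambda>c d x. c x \<otimes>\<^bsub>R\<^esub> d x), one = (\<lambda>x. \<one>\<^bsub>R\<^esub>),
     zero = (\<lambda>x. \<zero>\<^bsub>R\<^esub>), add = (\<lambda>c d x. c x \<oplus>\<^bsub>R\<^esub> d x), ract = (\<lambda>c a x. c x \<otimes>\<^bsub>R\<^esub> a)\<rparr>"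

definition lin_comb ::
    "('a, 'r) ring_scheme \<Rightarrow> ('a, 'm) rmodule \<Rightarrow> ('x \<Rightarrow> 'm) \<Rightarrow> ('x \<Rightarrow> 'a) \<Rightarrow> 'm" where
  "lin_comb R M t c = (\<Oplus>\<^bsub>M\<^esub>x\<in>{x. c x \<noteq> \<zero>\<^bsub>R\<^esub>}. t x \<triangleleft>\<^bsub>M\<^esub> c x)"

lemma free_rmodule_right_module:
  assumes "ring R" shows "right_module R (free_rmodule R B)"
proof -
  interpret ring R by fact
  let ?F = "free_rmodule R B"
  have car: "c \<in> carrier ?F \<longleftrightarrow> (\<forall>x. c x \<in> carrier R) \<and> finite {x. c x \<noteq> \<zero>\<^bsub>R\<^esub>} \<and>
       {x. c x \<noteq> \<zero>\<^bsub>R\<^esub>} \<subseteq> B" for c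
    by (auto simp: free_rmodule_def)
  have add: "(\<lambda>x. c x \<oplus>\<^bsub>R\<^esub> d x) \<in> carrier ?F" if "c \<in> carrier ?F" "d \<in> carrier ?F" for c d
  proof -
    have "{x. c x \<oplus>\<^bsub>R\<^esub> d x \<noteq> \<zero>\<^bsub>R\<^esub>} \<subseteq> {x. c x \<noteq> \<zero>\<^bsub>R\<^esub>} \<union> {x. d x \<noteq> \<zero>\<^bsub>R\<^esub>}" by auto
    with that show ?thesis unfolding car by (auto intro: finite_subset)
  qed
  have act: "(\<lambda>x. c x \<otimes>\<^bsub>R\<^esub> a) \<in> carrier ?F" if "c \<in> carrier ?F" "a \<in> carrier R" for c a
  proof -
    have "{x. c x \<otimes>\<^bsub>R\<^esub> a \<noteq> \<zero>\<^bsub>R\<^esub>} \<subseteq> {x. c x \<noteq> \<zero>\<^bsub>R\<^esub>}" using that by auto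
    with that show ?thesis unfolding car by (auto intro: finite_subset)
  qed
  have neg: "(\<lambda>x. \<ominus>\<^bsub>R\<^esub> c x) \<in> carrier ?F" if "c \<in> carrier ?F" for c
  proof -
    have "{x. \<ominus>\<^bsub>R\<^esub> c x \<noteq> \<zero>\<^bsub>R\<^esub>} \<subseteq> {x. c x \<noteq> \<zero>\<^bsub>R\<^esub>}" by auto
    with that show ?thesis unfolding car by (auto intro: finite_subset)
  qed
  have sim: "add ?F = (\<lambda>c d x. c x \<oplus>\<^bsub>R\<^esub> d x)" "zero ?F = (\<lambda>x. \<zero>\<^bsub>R\<^esub>)"
     "ract ?F = (\<lambda>c a x. c x \<otimes>\<^bsub>R\<^esub> a)"
    by (auto simp: free_rmodule_def)
  have val: "c x \<in> carrier R" if "c \<in> carrier ?F" for c x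
    using that unfolding car by blast
  have "abelian_group ?F"
  proof (rule abelian_groupI)
    fix c assume c: "c \<in> carrier ?F"
    show "\<exists>d\<in>carrier ?F. d \<oplus>\<^bsub>?F\<^esub> c = \<zero>\<^bsub>?F\<^esub>"
      by (rule bexI[OF _ neg[OF c]]) (simp add: sim l_neg val[OF c])
    show "\<zero>\<^bsub>?F\<^esub> \<oplus>\<^bsub>?F\<^esub> c = c" by (simp add: sim val[OF c])
    fix d assume d: "d \<in> carrier ?F"
    show "c \<oplus>\<^bsub>?F\<^esub> d \<in> carrier ?F" using add[OF c d] by (simp add: sim)
    show "c \<oplus>\<^bsub>?F\<^esub> d = d \<oplus>\<^bsub>?F\<^esub> c" by (simp add: sim a_comm val[OF c] val[OF d])
    fix e assume e: "e \<in> carrier ?F"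
    show "c \<oplus>\<^bsub>?F\<^esub> d \<oplus>\<^bsub>?F\<^esub> e = c \<oplus>\<^bsub>?F\<^esub> (d \<oplus>\<^bsub>?F\<^esub> e)"
      by (simp add: sim a_assoc val[OF c] val[OF d] val[OF e])
  next
    show "\<zero>\<^bsub>?F\<^esub> \<in> carrier ?F" by (simp add: sim car)
  qed
  moreover have "right_module_axioms R ?F"
  proof (rule right_module_axioms.intro)
    fix c a assume c: "c \<in> carrier ?F" and a: "a \<in> carrier R"
    show "c \<triangleleft>\<^bsub>?F\<^esub> a \<in> carrier ?F" using act[OF c a] by (simp add: sim)
    fix d assume d: "d \<in> carrier ?F"
    show "(c \<oplus>\<^bsub>?F\<^esub> d) \<triangleleft>\<^bsub>?F\<^esub> a = c \<triangleleft>\<^bsub>?F\<^esub> a \<oplus>\<^bsub>?F\<^esub> d \<triangleleft>\<^bsub>?F\<^esub> a"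
      by (simp add: sim l_distr val[OF c] val[OF d] a)
  next
    fix c a b assume c: "c \<in> carrier ?F" and a: "a \<in> carrier R" and b: "b \<in> carrier R"
    show "c \<triangleleft>\<^bsub>?F\<^esub> (a \<oplus>\<^bsub>R\<^esub> b) = c \<triangleleft>\<^bsub>?F\<^esub> a \<oplus>\<^bsub>?F\<^esub> c \<triangleleft>\<^bsub>?F\<^esub> b"
      by (simp add: sim r_distr val[OF c] a b)
    show "c \<triangleleft>\<^bsub>?F\<^esub> (a \<otimes>\<^bsub>R\<^esub> b) = (c \<triangleleft>\<^bsub>?F\<^esub> a) \<triangleleft>\<^bsub>?F\<^esub> b"
      by (simp add: sim m_assoc val[OF c] a b)
  next
    fix c assume c: "c \<in> carrier ?F"
    show "c \<triangleleft>\<^bsub>?F\<^esub> \<one>\<^bsub>R\<^esub> = c" by (simp add: sim val[OF c])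
  qed
  ultimately show ?thesis using assms by (simp add: right_module_def)
qed

context right_module
begin

lemma lin_comb_superset:
  assumes "c \<in> carrier (free_rmodule R B)" "t \<in> B \<rightarrow> carrier M"
    and "finite S" "{x. c x \<noteq> \<zero>\<^bsub>R\<^esub>} \<subseteq> S" "S \<subseteq> B"
  shows "lin_comb R M t c = (\<Oplus>\<^bsub>M\<^esub>x\<in>S. t x \<triangleleft>\<^bsub>M\<^esub> c x)"
  unfolding lin_comb_def
proof (rule M.add.finprod_mono_neutral_cong_left[OF assms(3,4)])
  show "t x \<triangleleft>\<^bsub>M\<^esub> c x = \<zero>\<^bsub>M\<^esub>" if "x \<in> S - {x. c x \<noteq> \<zero>\<^bsub>R\<^esub>}" for x
  proof -
    have "t x \<in> carrier M" using that assms(5) by (intro funcset_mem[OF assms(2)]) blast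
    moreover have "c x = \<zero>\<^bsub>R\<^esub>" using that by blast
    ultimately show ?thesis by simp
  qed
  show "(\<lambda>x. t x \<triangleleft>\<^bsub>M\<^esub> c x) \<in> S \<rightarrow> carrier M"
  proof
    fix x assume "x \<in> S"
    then have "t x \<in> carrier M" using assms(5) by (intro funcset_mem[OF assms(2)]) blast
    moreover have "c x \<in> carrier R" using assms(1) by (simp add: free_rmodule_def range_subsetD)
    ultimately show "t x \<triangleleft>\<^bsub>M\<^esub> c x \<in> carrier M" by simp
  qed
qed simp

lemma lin_comb_hom:
  assumes t: "t \<in> B \<rightarrow> carrier M"
  shows "lin_comb R M t \<in> rmod_hom R (free_rmodule R B) M"
proof -
  let ?F = "free_rmodule R B"
  let ?s = "\<lambda>c. {x. c x \<noteq> \<zero>\<^bsub>R\<^esub>}"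
  interpret F: right_module R ?F by (rule free_rmodule_right_module) (rule R.ring_axioms)
  have fin: "finite (?s c)" "?s c \<subseteq> B" if "c \<in> carrier ?F" for c
    using that by (auto simp: free_rmodule_def)
  have val: "c x \<in> carrier R" if "c \<in> carrier ?F" for c x
    using that by (auto simp: free_rmodule_def)
  have sim: "c \<oplus>\<^bsub>?F\<^esub> d = (\<lambda>x. c x \<oplus>\<^bsub>R\<^esub> d x)" "c \<triangleleft>\<^bsub>?F\<^esub> a = (\<lambda>x. c x \<otimes>\<^bsub>R\<^esub> a)" for c d a
    by (auto simp: free_rmodule_def)
  have cl: "(\<lambda>x. t x \<triangleleft>\<^bsub>M\<^esub> c x) \<in> S \<rightarrow> carrier M" if "c \<in> carrier ?F" "S \<subseteq> B" for c S
    using that funcset_mem[OF t] by (auto intro!: ract_closed val)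
  have "lin_comb R M t c \<in> carrier M" if "c \<in> carrier ?F" for c
    unfolding lin_comb_def by (rule M.finsum_closed[OF cl[OF that fin(2)[OF that]]])
  moreover have "lin_comb R M t (c \<oplus>\<^bsub>?F\<^esub> d) = lin_comb R M t c \<oplus>\<^bsub>M\<^esub> lin_comb R M t d"
    if c: "c \<in> carrier ?F" and d: "d \<in> carrier ?F" for c d
  proof -
    let ?S = "?s c \<union> ?s d"
    have S: "finite ?S" "?S \<subseteq> B" using fin c d by auto
    have "lin_comb R M t (c \<oplus>\<^bsub>?F\<^esub> d) = (\<Oplus>\<^bsub>M\<^esub>x\<in>?S. t x \<triangleleft>\<^bsub>M\<^esub> (c \<oplus>\<^bsub>?F\<^esub> d) x)"
      by (rule lin_comb_superset[OF F.M.a_closed[OF c d] t S(1) _ S(2)]) (auto simp: sim)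
    also have "\<dots> = (\<Oplus>\<^bsub>M\<^esub>x\<in>?S. t x \<triangleleft>\<^bsub>M\<^esub> c x \<oplus>\<^bsub>M\<^esub> t x \<triangleleft>\<^bsub>M\<^esub> d x)"
    proof (intro M.finsum_cong')
      show "(\<lambda>x. t x \<triangleleft>\<^bsub>M\<^esub> c x \<oplus>\<^bsub>M\<^esub> t x \<triangleleft>\<^bsub>M\<^esub> d x) \<in> ?S \<rightarrow> carrier M"
        using funcset_mem[OF cl[OF c S(2)]] funcset_mem[OF cl[OF d S(2)]] by blast
      show "t x \<triangleleft>\<^bsub>M\<^esub> (c \<oplus>\<^bsub>?F\<^esub> d) x = t x \<triangleleft>\<^bsub>M\<^esub> c x \<oplus>\<^bsub>M\<^esub> t x \<triangleleft>\<^bsub>M\<^esub> d x" if "x \<in> ?S" for x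
        unfolding sim
        by (rule ract_add_right[OF funcset_mem[OF t subsetD[OF S(2) that]] val[OF c] val[OF d]])
    qed simp
    also have "\<dots> = (\<Oplus>\<^bsub>M\<^esub>x\<in>?S. t x \<triangleleft>\<^bsub>M\<^esub> c x) \<oplus>\<^bsub>M\<^esub> (\<Oplus>\<^bsub>M\<^esub>x\<in>?S. t x \<triangleleft>\<^bsub>M\<^esub> d x)"
      by (rule M.finsum_addf[OF cl[OF c S(2)] cl[OF d S(2)]])
    also have "\<dots> = lin_comb R M t c \<oplus>\<^bsub>M\<^esub> lin_comb R M t d"
      using lin_comb_superset[OF c t S(1) _ S(2)] lin_comb_superset[OF d t S(1) _ S(2)] by simp
    finally show ?thesis .
  qed
  moreover have "lin_comb R M t (c \<triangleleft>\<^bsub>?F\<^esub> a) = lin_comb R M t c \<triangleleft>\<^bsub>M\<^esub> a"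
    if c: "c \<in> carrier ?F" and a: "a \<in> carrier R" for c a
  proof -
    have "lin_comb R M t (c \<triangleleft>\<^bsub>?F\<^esub> a) = (\<Oplus>\<^bsub>M\<^esub>x\<in>?s c. t x \<triangleleft>\<^bsub>M\<^esub> (c \<triangleleft>\<^bsub>?F\<^esub> a) x)"
      by (rule lin_comb_superset[OF F.ract_closed[OF c a] t fin(1)[OF c] _ fin(2)[OF c]])
         (use a in \<open>auto simp: sim\<close>)
    also have "\<dots> = (\<Oplus>\<^bsub>M\<^esub>x\<in>?s c. (t x \<triangleleft>\<^bsub>M\<^esub> c x) \<triangleleft>\<^bsub>M\<^esub> a)"
    proof (intro M.finsum_cong')
      show "(\<lambda>x. (t x \<triangleleft>\<^bsub>M\<^esub> c x) \<triangleleft>\<^bsub>M\<^esub> a) \<in> ?s c \<rightarrow> carrier M"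
        using funcset_mem[OF cl[OF c fin(2)[OF c]]] a by blast
      show "t x \<triangleleft>\<^bsub>M\<^esub> (c \<triangleleft>\<^bsub>?F\<^esub> a) x = (t x \<triangleleft>\<^bsub>M\<^esub> c x) \<triangleleft>\<^bsub>M\<^esub> a" if "x \<in> ?s c" for x
        unfolding sim
        by (rule ract_mult[OF funcset_mem[OF t subsetD[OF fin(2)[OF c] that]] val[OF c] a])
    qed simp
    also have "\<dots> = lin_comb R M t c \<triangleleft>\<^bsub>M\<^esub> a"
      unfolding lin_comb_def by (rule finsum_ract[symmetric, OF fin(1)[OF c] cl[OF c fin(2)[OF c]] a])
    finally show ?thesis .
  qed
  ultimately show ?thesis unfolding rmod_hom_def by blast
qed

end

lemma hom_lin_comb:
  assumes "right_module R M" "right_module R N" "f \<in> rmod_hom R M N"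
    and t: "t \<in> B \<rightarrow> carrier M" and c: "c \<in> carrier (free_rmodule R B)"
  shows "f (lin_comb R M t c) = lin_comb R N (\<lambda>x. f (t x)) c"
proof -
  interpret M: right_module R M by fact
  interpret N: right_module R N by fact
  let ?s = "{x. c x \<noteq> \<zero>\<^bsub>R\<^esub>}"
  have fin: "finite ?s" "?s \<subseteq> B" and val: "\<And>x. c x \<in> carrier R"
    using c by (auto simp: free_rmodule_def)
  have tx: "t x \<in> carrier M" if "x \<in> ?s" for x using that fin t by auto
  have "f (lin_comb R M t c) = (\<Oplus>\<^bsub>N\<^esub>x\<in>?s. f (t x \<triangleleft>\<^bsub>M\<^esub> c x))"
    unfolding lin_comb_def by (rule rmod_hom_finsum[OF assms(1-3) fin(1)]) (use tx val in auto)
  also have "\<dots> = (\<Oplus>\<^bsub>N\<^esub>x\<in>?s. f (t x) \<triangleleft>\<^bsub>N\<^esub> c x)"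
    by (rule N.M.finsum_cong') (use tx val rmod_homD[OF assms(3)] in auto)
  finally show ?thesis by (simp add: lin_comb_def)
qed

lemma projective_lift:
  fixes M :: "('a, 'm) rmodule" and N :: "('a, 'n) rmodule" and L :: "('a, 'l) rmodule"
  assumes "right_module R M" "projective R M"
    and "right_module R N" "right_module R L"
    and f: "f \<in> rmod_hom R N L" "f ` carrier N = carrier L" and g: "g \<in> rmod_hom R M L"
  shows "\<exists>k \<in> rmod_hom R M N. \<forall>x\<in>carrier M. f (k x) = g x"
proof -
  interpret M: right_module R M by fact
  interpret N: right_module R N by fact
  interpret L: right_module R L by fact
  let ?B = "carrier M"
  let ?F = "free_rmodule R ?B"
  let ?p = "lin_comb R M (\<lambda>x. x)"
  have F: "right_module R ?F" by (rule free_rmodule_right_module) (rule M.R.ring_axioms)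
  have p: "?p \<in> rmod_hom R ?F M" by (rule M.lin_comb_hom) auto
  have "x \<in> ?p ` carrier ?F" if x: "x \<in> ?B" for x
  proof -
    define c where "c = (\<lambda>y. if y = x then \<one>\<^bsub>R\<^esub> else \<zero>\<^bsub>R\<^esub>)"
    have s: "{y. c y \<noteq> \<zero>\<^bsub>R\<^esub>} \<subseteq> {x}" unfolding c_def by auto
    then have c: "c \<in> carrier ?F"
      using x by (auto simp: free_rmodule_def c_def intro: finite_subset)
    have "?p c = (\<Oplus>\<^bsub>M\<^esub>y\<in>{x}. y \<triangleleft>\<^bsub>M\<^esub> c y)"
      by (rule M.lin_comb_superset[OF c _ _ s]) (use x in auto)
    also have "\<dots> = x" using x by (simp add: c_def)
    finally show ?thesis using c by force
  qed
  then have surj: "?p ` carrier ?F = ?B" using rmod_homD(1)[OF p] by auto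
  have "(\<lambda>x. x) \<in> rmod_hom R M M" by (auto simp: rmod_hom_def)
  then obtain k where k: "k \<in> rmod_hom R M ?F" "\<forall>x\<in>?B. ?p (k x) = x"
    using assms(2) F assms(1) p surj unfolding projective_def by blast
  have "\<forall>x\<in>?B. \<exists>y\<in>carrier N. f y = g x"
    using f(2) rmod_homD(1)[OF g] by (metis imageE)
  then obtain t where t: "\<And>x. x \<in> ?B \<Longrightarrow> t x \<in> carrier N \<and> f (t x) = g x" by metis
  have q: "lin_comb R N t \<in> rmod_hom R ?F N" by (rule N.lin_comb_hom) (use t in auto)
  have "f (lin_comb R N t (k x)) = g x" if x: "x \<in> ?B" for x
  proof -
    have kx: "k x \<in> carrier ?F" using rmod_homD(1)[OF k(1) x] .
    have sub: "{y. k x y \<noteq> \<zero>\<^bsub>R\<^esub>} \<subseteq> ?B" and val: "\<And>y. k x y \<in> carrier R"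
      using kx by (auto simp: free_rmodule_def)
    have "f (lin_comb R N t (k x)) = lin_comb R L (\<lambda>x. f (t x)) (k x)"
      by (rule hom_lin_comb[OF assms(3,4) f(1) _ kx]) (use t in auto)
    also have "\<dots> = lin_comb R L g (k x)"
      unfolding lin_comb_def
    proof (rule L.M.finsum_cong')
      show "(\<lambda>y. g y \<triangleleft>\<^bsub>L\<^esub> k x y) \<in> {y. k x y \<noteq> \<zero>\<^bsub>R\<^esub>} \<rightarrow> carrier L"
      proof
        fix y assume "y \<in> {y. k x y \<noteq> \<zero>\<^bsub>R\<^esub>}"
        then have "y \<in> ?B" using sub by (rule rev_subsetD)
        then show "g y \<triangleleft>\<^bsub>L\<^esub> k x y \<in> carrier L"
          by (intro L.ract_closed rmod_homD(1)[OF g] val)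
      qed
      show "f (t y) \<triangleleft>\<^bsub>L\<^esub> k x y = g y \<triangleleft>\<^bsub>L\<^esub> k x y" if "y \<in> {y. k x y \<noteq> \<zero>\<^bsub>R\<^esub>}" for y
        using t[OF subsetD[OF sub that]] by simp
    qed simp
    also have "\<dots> = g (?p (k x))"
      by (rule hom_lin_comb[OF assms(1,4) g _ kx, symmetric]) (rule Pi_I)
    also have "\<dots> = g x" by (simp only: bspec[OF k(2) x])
    finally show ?thesis .
  qed
  then show ?thesis by (intro bexI[OF _ rmod_hom_comp[OF k(1) q]] ballI)
qed

end

theory Submission
  imports Defs
begin

text \<open>
  Both sides are equivalent to the existence of \<open>w\<^sub>1, \<dots>, w\<^sub>n\<close> in \<open>M\<close> with
  \<open>x = \<Sum>\<^sub>r e\<^sub>r h(w\<^sub>r, x)\<close> for all \<open>x\<close>. For a regular module this is a dual basis whose functionals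
  are represented through the form. Then \<open>h(y, x) = \<Sum>\<^sub>r h(y, w\<^sub>r) h(e\<^sub>r, x)\<close>, so nondegeneracy gives
  the reversed expansion \<open>x = \<Sum>\<^sub>r w\<^sub>r h(e\<^sub>r, x)\<close>, and the hermitian matrix \<open>h\<^sup>r\<^sup>s = h(w\<^sub>r, w\<^sub>s)\<close> works.
  Conversely \<open>w\<^sub>r = \<Sum>\<^sub>s e\<^sub>s (h\<^sup>r\<^sup>s)\<^sup>*\<close>.
\<close>

section \<open>The ring as a right module over itself\<close>

lemma self_rmodule_simps [simp]:
  "carrier (self_rmodule R) = carrier R"
  "\<zero>\<^bsub>self_rmodule R\<^esub> = \<zero>\<^bsub>R\<^esub>"
  "x \<oplus>\<^bsub>self_rmodule R\<^esub> y = x \<oplus>\<^bsub>R\<^esub> y"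
  "x \<triangleleft>\<^bsub>self_rmodule R\<^esub> a = x \<otimes>\<^bsub>R\<^esub> a"
  by (simp_all add: self_rmodule_def)

text \<open>\<open>finsum\<close> reads only the carrier, the addition and the zero, which
  \<open>self_rmodule\<close> copies from the ring. General facts on homomorphisms and sums thereby
  apply to functionals.\<close>

lemma finsum_self_rmodule [simp]: "finsum (self_rmodule R) t S = finsum R t S"
  by (simp add: finsum_def finprod_def self_rmodule_def)

lemma self_rmodule_right_module:
  assumes "ring R" shows "right_module R (self_rmodule R)"
proof -
  interpret ring R by fact
  have "abelian_group (self_rmodule R)"
    by (rule abelian_groupI) (auto simp: a_assoc intro: a_comm l_neg)
  moreover have "right_module_axioms R (self_rmodule R)"
    by (rule right_module_axioms.intro) (auto simp: l_distr r_distr m_assoc)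
  ultimately show ?thesis using assms by (simp add: right_module_def)
qed

section \<open>Sums, generators and dual bases in right modules\<close>

context right_module
begin

text \<open>Acting on a fixed \<open>x\<close> is a homomorphism from the ring, as a right module
  over itself, to \<open>M\<close>, and homomorphisms commute with finite sums.\<close>

lemma ract_finsum:
  assumes "finite S" "x \<in> carrier M" "c \<in> S \<rightarrow> carrier R"
  shows "x \<triangleleft>\<^bsub>M\<^esub> (\<Oplus>\<^bsub>R\<^esub>i\<in>S. c i) = (\<Oplus>\<^bsub>M\<^esub>i\<in>S. x \<triangleleft>\<^bsub>M\<^esub> c i)"
proof -
  have "(\<lambda>a. x \<triangleleft>\<^bsub>M\<^esub> a) \<in> rmod_hom R (self_rmodule R) M"
    using assms(2) by (auto simp: rmod_hom_def ract_add_right ract_mult)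
  from rmod_hom_finsum[OF self_rmodule_right_module[OF R.ring_axioms] right_module_axioms this assms(1)]
  show ?thesis using assms(3) by simp
qed

text \<open>Functional values act on the right of the fixed vectors \<open>t i\<close>, so right
  linearity of each \<open>\<theta> i\<close> passes to the sum. Such sums serve both as lifts and
  as expansion maps.\<close>

lemma finsum_functionals_hom:
  assumes "finite S" "t \<in> S \<rightarrow> carrier M"
    and \<theta>: "\<And>i. i \<in> S \<Longrightarrow> \<theta> i \<in> rmod_hom R N (self_rmodule R)"
  shows "(\<lambda>x. \<Oplus>\<^bsub>M\<^esub>i\<in>S. t i \<triangleleft>\<^bsub>M\<^esub> \<theta> i x) \<in> rmod_hom R N M"
proof -
  have cl: "(\<lambda>i. t i \<triangleleft>\<^bsub>M\<^esub> \<theta> i x) \<in> S \<rightarrow> carrier M" if "x \<in> carrier N" for x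
    using assms(2) rmod_homD(1)[OF \<theta> that] by auto
  have "(\<Oplus>\<^bsub>M\<^esub>i\<in>S. t i \<triangleleft>\<^bsub>M\<^esub> \<theta> i (x \<oplus>\<^bsub>N\<^esub> y)) =
      (\<Oplus>\<^bsub>M\<^esub>i\<in>S. t i \<triangleleft>\<^bsub>M\<^esub> \<theta> i x) \<oplus>\<^bsub>M\<^esub> (\<Oplus>\<^bsub>M\<^esub>i\<in>S. t i \<triangleleft>\<^bsub>M\<^esub> \<theta> i y)"
    if x: "x \<in> carrier N" and y: "y \<in> carrier N" for x y
  proof -
    have "t i \<triangleleft>\<^bsub>M\<^esub> \<theta> i (x \<oplus>\<^bsub>N\<^esub> y) = t i \<triangleleft>\<^bsub>M\<^esub> \<theta> i x \<oplus>\<^bsub>M\<^esub> t i \<triangleleft>\<^bsub>M\<^esub> \<theta> i y" if "i \<in> S" for i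
      using rmod_homD(1,2)[OF \<theta>[OF that]] x y that assms(2) by (auto intro!: ract_add_right)
    then have "(\<Oplus>\<^bsub>M\<^esub>i\<in>S. t i \<triangleleft>\<^bsub>M\<^esub> \<theta> i (x \<oplus>\<^bsub>N\<^esub> y)) =
        (\<Oplus>\<^bsub>M\<^esub>i\<in>S. t i \<triangleleft>\<^bsub>M\<^esub> \<theta> i x \<oplus>\<^bsub>M\<^esub> t i \<triangleleft>\<^bsub>M\<^esub> \<theta> i y)"
      using cl[OF x] cl[OF y] by (intro M.finsum_cong') auto
    then show ?thesis using M.finsum_addf[OF cl[OF x] cl[OF y]] by simp
  qed
  moreover have "(\<Oplus>\<^bsub>M\<^esub>i\<in>S. t i \<triangleleft>\<^bsub>M\<^esub> \<theta> i (x \<triangleleft>\<^bsub>N\<^esub> a)) = (\<Oplus>\<^bsub>M\<^esub>i\<in>S. t i \<triangleleft>\<^bsub>M\<^esub> \<theta> i x) \<triangleleft>\<^bsub>M\<^esub> a"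
    if x: "x \<in> carrier N" and a: "a \<in> carrier R" for x a
  proof -
    have "t i \<triangleleft>\<^bsub>M\<^esub> \<theta> i (x \<triangleleft>\<^bsub>N\<^esub> a) = (t i \<triangleleft>\<^bsub>M\<^esub> \<theta> i x) \<triangleleft>\<^bsub>M\<^esub> a" if "i \<in> S" for i
      using rmod_homD(1,3)[OF \<theta>[OF that]] x a that assms(2) by (auto intro!: ract_mult)
    then have "(\<Oplus>\<^bsub>M\<^esub>i\<in>S. t i \<triangleleft>\<^bsub>M\<^esub> \<theta> i (x \<triangleleft>\<^bsub>N\<^esub> a)) = (\<Oplus>\<^bsub>M\<^esub>i\<in>S. (t i \<triangleleft>\<^bsub>M\<^esub> \<theta> i x) \<triangleleft>\<^bsub>M\<^esub> a)"
      using cl[OF x] a by (intro M.finsum_cong') auto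
    then show ?thesis using finsum_ract[OF assms(1) cl[OF x] a] by simp
  qed
  ultimately show ?thesis using M.finsum_closed[OF cl] unfolding rmod_hom_def by blast
qed

text \<open>Both maps commute with the sum and the action in any expression of \<open>x\<close>
  through the generators. This later extends an identity from the \<open>e c\<close> to all of
  \<open>M\<close>.\<close>

lemma rmod_hom_eq_on_generators:
  assumes gen: "generates R M n e" and "right_module R N"
    and f: "f \<in> rmod_hom R M N" and g: "g \<in> rmod_hom R M N"
    and eq: "\<And>i. i \<in> {1..n} \<Longrightarrow> f (e i) = g (e i)" and x: "x \<in> carrier M"
  shows "f x = g x"
proof -
  interpret N: right_module R N by fact
  obtain c where c: "c \<in> {1..n} \<rightarrow> carrier R" and x_eq: "x = (\<Oplus>\<^bsub>M\<^esub>i\<in>{1..n}. e i \<triangleleft>\<^bsub>M\<^esub> c i)"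
    using gen x unfolding generates_def by blast
  have e: "e \<in> {1..n} \<rightarrow> carrier M" using gen by (simp add: generates_def)
  have cl: "(\<lambda>i. e i \<triangleleft>\<^bsub>M\<^esub> c i) \<in> {1..n} \<rightarrow> carrier M" using e c by auto
  have "f (e i \<triangleleft>\<^bsub>M\<^esub> c i) = g (e i \<triangleleft>\<^bsub>M\<^esub> c i)" if "i \<in> {1..n}" for i
    using rmod_homD(3)[OF f] rmod_homD(3)[OF g] eq[OF that] e c that by (simp add: Pi_iff)
  then have "(\<Oplus>\<^bsub>N\<^esub>i\<in>{1..n}. f (e i \<triangleleft>\<^bsub>M\<^esub> c i)) = (\<Oplus>\<^bsub>N\<^esub>i\<in>{1..n}. g (e i \<triangleleft>\<^bsub>M\<^esub> c i))"
    using cl rmod_homD(1)[OF g] by (intro N.M.finsum_cong') auto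
  then show ?thesis
    unfolding x_eq
    using rmod_hom_finsum[OF right_module_axioms assms(2) f _ cl]
      rmod_hom_finsum[OF right_module_axioms assms(2) g _ cl] by simp
qed

text \<open>The generators give a surjection from the free module on \<open>{1..n}\<close> onto
  \<open>M\<close>. Projectivity splits it, and the coordinates of the splitting are the functionals
  \<open>\<theta> r\<close>.\<close>

lemma generates_projective_imp_dual_basis:
  assumes gen: "generates R M n e" and proj: "projective R M"
  obtains \<theta> where "\<And>r. \<theta> r \<in> rmod_hom R M (self_rmodule R)"
    "\<And>x. x \<in> carrier M \<Longrightarrow> x = (\<Oplus>\<^bsub>M\<^esub>r\<in>{1..n}. e r \<triangleleft>\<^bsub>M\<^esub> \<theta> r x)"
proof -
  let ?F = "free_rmodule R {1..n}"
  have e: "e \<in> {1..n} \<rightarrow> carrier M" using gen by (simp add: generates_def)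
  have F: "right_module R ?F" by (rule free_rmodule_right_module) (rule R.ring_axioms)
  have p: "lin_comb R M e \<in> rmod_hom R ?F M" by (rule lin_comb_hom[OF e])
  \<comment> \<open>\<open>lin_comb\<close> sums over the support of \<open>c\<close> only; the
    remaining indices in \<open>{1..n}\<close> contribute zero.\<close>
  have lc: "lin_comb R M e c = (\<Oplus>\<^bsub>M\<^esub>r\<in>{1..n}. e r \<triangleleft>\<^bsub>M\<^esub> c r)" if "c \<in> carrier ?F" for c
    using that by (intro lin_comb_superset[OF that e]) (auto simp: free_rmodule_def)
  have "x \<in> lin_comb R M e ` carrier ?F" if x: "x \<in> carrier M" for x
  proof -
    obtain c where c: "c \<in> {1..n} \<rightarrow> carrier R" and x_eq: "x = (\<Oplus>\<^bsub>M\<^esub>i\<in>{1..n}. e i \<triangleleft>\<^bsub>M\<^esub> c i)"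
      using gen x unfolding generates_def by blast
    \<comment> \<open>Elements of the free module vanish outside \<open>{1..n}\<close>, whereas
      \<open>c\<close> is arbitrary there, so it is cut off to zero.\<close>
    define d where "d = (\<lambda>i. if i \<in> {1..n} then c i else \<zero>\<^bsub>R\<^esub>)"
    have "{i. d i \<noteq> \<zero>\<^bsub>R\<^esub>} \<subseteq> {1..n}" by (auto simp: d_def)
    moreover from this have "finite {i. d i \<noteq> \<zero>\<^bsub>R\<^esub>}" by (rule finite_subset) simp
    moreover have "range d \<subseteq> carrier R" using c by (auto simp: d_def Pi_iff)
    ultimately have d: "d \<in> carrier ?F" by (simp add: free_rmodule_def)
    have "x = (\<Oplus>\<^bsub>M\<^esub>i\<in>{1..n}. e i \<triangleleft>\<^bsub>M\<^esub> d i)"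
      unfolding x_eq using e c by (intro M.finsum_cong') (auto simp: d_def Pi_iff)
    then show ?thesis using lc[OF d] d by (metis image_eqI)
  qed
  then have surj: "lin_comb R M e ` carrier ?F = carrier M" using rmod_homD(1)[OF p] by auto
  have "(\<lambda>x. x) \<in> rmod_hom R M M" by (auto simp: rmod_hom_def)
  \<comment> \<open>The free module here lives on the type of functions on \<open>nat\<close>, not
    on the type fixed in \<open>projective\<close>; \<open>projective_lift\<close> bridges this.
    Lifting the identity along the surjection yields the section \<open>k\<close>.\<close>
  from projective_lift[OF right_module_axioms proj F right_module_axioms p surj this]
  obtain k where k: "k \<in> rmod_hom R M ?F" and pk: "\<And>x. x \<in> carrier M \<Longrightarrow> lin_comb R M e (k x) = x"
    by blast
  show thesis
  proof
    \<comment> \<open>The operations of the free module are pointwise, so evaluation at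
      \<open>r\<close> preserves them.\<close>
    show "(\<lambda>x. k x r) \<in> rmod_hom R M (self_rmodule R)" for r
      using k by (auto simp: rmod_hom_def free_rmodule_def Pi_iff range_subsetD)
    show "x = (\<Oplus>\<^bsub>M\<^esub>r\<in>{1..n}. e r \<triangleleft>\<^bsub>M\<^esub> k x r)" if "x \<in> carrier M" for x
      using lc[OF rmod_homD(1)[OF k that]] pk[OF that] by simp
  qed
qed

text \<open>A lift of \<open>g\<close> along \<open>f\<close> is obtained by choosing preimages
  \<open>t r\<close> of the \<open>g (e r)\<close> and replacing each \<open>e r\<close> by
  \<open>t r\<close> in the expansion of \<open>x\<close>.\<close>

lemma dual_basis_imp_projective:
  assumes e: "e \<in> {1..n::nat} \<rightarrow> carrier M"
    and \<theta>: "\<And>r. r \<in> {1..n} \<Longrightarrow> \<theta> r \<in> rmod_hom R M (self_rmodule R)"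
    and expand: "\<And>x. x \<in> carrier M \<Longrightarrow> x = (\<Oplus>\<^bsub>M\<^esub>r\<in>{1..n}. e r \<triangleleft>\<^bsub>M\<^esub> \<theta> r x)"
  shows "projective R M"
  unfolding projective_def
proof (intro allI impI)
  fix N :: "('a, 'm \<Rightarrow> 'a) rmodule" and L :: "('a, 'm) rmodule" and f g
  assume N: "right_module R N" and L: "right_module R L"
    and f: "f \<in> rmod_hom R N L" and surj: "f ` carrier N = carrier L" and g: "g \<in> rmod_hom R M L"
  interpret N: right_module R N by fact
  interpret L: right_module R L by fact
  have "\<exists>y. y \<in> carrier N \<and> f y = g (e r)" if "r \<in> {1..n}" for r
  proof -
    have "g (e r) \<in> f ` carrier N"
      unfolding surj by (rule rmod_homD(1)[OF g funcset_mem[OF e that]])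
    then show ?thesis by (auto simp: eq_commute)
  qed
  then obtain t where t: "\<And>r. r \<in> {1..n} \<Longrightarrow> t r \<in> carrier N" "\<And>r. r \<in> {1..n} \<Longrightarrow> f (t r) = g (e r)"
    by metis
  have "f (\<Oplus>\<^bsub>N\<^esub>r\<in>{1..n}. t r \<triangleleft>\<^bsub>N\<^esub> \<theta> r x) = g x" if x: "x \<in> carrier M" for x
  proof -
    have val: "\<theta> r x \<in> carrier R" if "r \<in> {1..n}" for r using rmod_homD(1)[OF \<theta>[OF that] x] by simp
    have er: "e r \<in> carrier M" if "r \<in> {1..n}" for r using e that by blast
    have "f (\<Oplus>\<^bsub>N\<^esub>r\<in>{1..n}. t r \<triangleleft>\<^bsub>N\<^esub> \<theta> r x) = (\<Oplus>\<^bsub>L\<^esub>r\<in>{1..n}. f (t r \<triangleleft>\<^bsub>N\<^esub> \<theta> r x))"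
      by (intro rmod_hom_finsum[OF N L f] Pi_I N.ract_closed t(1) val) simp
    also have "\<dots> = (\<Oplus>\<^bsub>L\<^esub>r\<in>{1..n}. g (e r \<triangleleft>\<^bsub>M\<^esub> \<theta> r x))"
    proof (rule L.M.finsum_cong')
      show "(\<lambda>r. g (e r \<triangleleft>\<^bsub>M\<^esub> \<theta> r x)) \<in> {1..n} \<rightarrow> carrier L"
        by (intro Pi_I rmod_homD(1)[OF g] ract_closed er val)
      show "f (t r \<triangleleft>\<^bsub>N\<^esub> \<theta> r x) = g (e r \<triangleleft>\<^bsub>M\<^esub> \<theta> r x)" if "r \<in> {1..n}" for r
        using rmod_homD(3)[OF f t(1)[OF that] val[OF that]] rmod_homD(3)[OF g er[OF that] val[OF that]]
          t(2)[OF that] by simp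
    qed simp
    also have "\<dots> = g (\<Oplus>\<^bsub>M\<^esub>r\<in>{1..n}. e r \<triangleleft>\<^bsub>M\<^esub> \<theta> r x)"
      by (intro rmod_hom_finsum[OF right_module_axioms L g, symmetric] Pi_I ract_closed er val) simp
    also have "\<dots> = g x" using expand[OF x] by simp
    finally show ?thesis .
  qed
  moreover have "(\<lambda>x. \<Oplus>\<^bsub>N\<^esub>r\<in>{1..n}. t r \<triangleleft>\<^bsub>N\<^esub> \<theta> r x) \<in> rmod_hom R M N"
    by (intro N.finsum_functionals_hom Pi_I t(1) \<theta>) simp
  ultimately show "\<exists>k\<in>rmod_hom R M N. \<forall>x\<in>carrier M. f (k x) = g x" by (intro bexI ballI)
qed

end

section \<open>Hermitian forms and expansions through the form\<close>

context right_hermitian_module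
begin

lemma self_rmodule: "right_module A (self_rmodule A)"
  by (rule self_rmodule_right_module) (rule A.A.ring_axioms)

text \<open>Additivity is postulated in the first argument; applying the star on both sides moves it
  to the second.\<close>

lemma form_add_right:
  assumes "x \<in> carrier M" "y \<in> carrier M" "z \<in> carrier M"
  shows "h x (y \<oplus>\<^bsub>M\<^esub> z) = h x y \<oplus> h x z"
proof -
  have "h x (y \<oplus>\<^bsub>M\<^esub> z) = star A (h (y \<oplus>\<^bsub>M\<^esub> z) x)" using assms by (simp add: form_star)
  also have "\<dots> = h x y \<oplus> h x z" using assms by (simp add: form_add star_add form_star)
  finally show ?thesis .
qed

lemma form_hom: "x \<in> carrier M \<Longrightarrow> h x \<in> rmod_hom A M (self_rmodule A)"
  by (auto simp: rmod_hom_def form_add_right form_ract)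

lemma form_ract_left:
  assumes "x \<in> carrier M" "y \<in> carrier M" "a \<in> carrier A"
  shows "h (x \<triangleleft>\<^bsub>M\<^esub> a) y = star A a \<otimes> h x y"
proof -
  have "h (x \<triangleleft>\<^bsub>M\<^esub> a) y = star A (h y (x \<triangleleft>\<^bsub>M\<^esub> a))" using assms by (simp add: form_star)
  also have "\<dots> = star A a \<otimes> h x y" using assms by (simp add: form_ract star_mult form_star)
  finally show ?thesis .
qed

lemma form_zero_left: "y \<in> carrier M \<Longrightarrow> h \<zero>\<^bsub>M\<^esub> y = \<zero>"
proof -
  assume y: "y \<in> carrier M"
  have "h \<zero>\<^bsub>M\<^esub> y \<oplus> h \<zero>\<^bsub>M\<^esub> y = h \<zero>\<^bsub>M\<^esub> y" using form_add[of "\<zero>\<^bsub>M\<^esub>" "\<zero>\<^bsub>M\<^esub>" y] y by simp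
  then show ?thesis using y by (metis A.A.add.r_cancel_one M.M.zero_closed form_closed)
qed

text \<open>In its first argument the form is additive but takes scalars out starred, so
  \<open>rmod_hom_finsum\<close> does not apply and the induction is done on additivity
  alone.\<close>

lemma form_finsum_left:
  assumes "finite S" "t \<in> S \<rightarrow> carrier M" "y \<in> carrier M"
  shows "h (\<Oplus>\<^bsub>M\<^esub>i\<in>S. t i) y = (\<Oplus>i\<in>S. h (t i) y)"
  using assms
proof (induction S rule: finite_induct)
  case (insert i S)
  then have "t \<in> S \<rightarrow> carrier M" "t i \<in> carrier M" "(\<lambda>i. h (t i) y) \<in> S \<rightarrow> carrier A"
    by auto
  with insert show ?case by (simp add: form_add)
qed (simp add: form_zero_left)

lemma form_lin_comb_right:
  assumes "finite S" "t \<in> S \<rightarrow> carrier M" "c \<in> S \<rightarrow> carrier A" "x \<in> carrier M"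
  shows "h x (\<Oplus>\<^bsub>M\<^esub>i\<in>S. t i \<triangleleft>\<^bsub>M\<^esub> c i) = (\<Oplus>i\<in>S. h x (t i) \<otimes> c i)"
proof -
  have "h x (\<Oplus>\<^bsub>M\<^esub>i\<in>S. t i \<triangleleft>\<^bsub>M\<^esub> c i) = (\<Oplus>i\<in>S. h x (t i \<triangleleft>\<^bsub>M\<^esub> c i))"
    using rmod_hom_finsum[OF M.right_module_axioms self_rmodule form_hom[OF assms(4)] assms(1),
        of "\<lambda>i. t i \<triangleleft>\<^bsub>M\<^esub> c i"] assms(2,3) by (auto simp: Pi_iff)
  also have "\<dots> = (\<Oplus>i\<in>S. h x (t i) \<otimes> c i)"
    using assms by (intro A.A.finsum_cong') (auto simp: form_ract Pi_iff)
  finally show ?thesis .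
qed

lemma form_lin_comb_left:
  assumes "finite S" "t \<in> S \<rightarrow> carrier M" "c \<in> S \<rightarrow> carrier A" "y \<in> carrier M"
  shows "h (\<Oplus>\<^bsub>M\<^esub>i\<in>S. t i \<triangleleft>\<^bsub>M\<^esub> c i) y = (\<Oplus>i\<in>S. star A (c i) \<otimes> h (t i) y)"
proof -
  have "h (\<Oplus>\<^bsub>M\<^esub>i\<in>S. t i \<triangleleft>\<^bsub>M\<^esub> c i) y = (\<Oplus>i\<in>S. h (t i \<triangleleft>\<^bsub>M\<^esub> c i) y)"
    using assms by (intro form_finsum_left) auto
  also have "\<dots> = (\<Oplus>i\<in>S. star A (c i) \<otimes> h (t i) y)"
    using assms by (intro A.A.finsum_cong') (auto simp: form_ract_left Pi_iff)
  finally show ?thesis .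
qed

text \<open>The expansion recovers a vector from the values \<open>h (w r)\<close> takes on it, and
  these agree for \<open>x\<close> and \<open>y\<close>.\<close>

lemma form_left_inverse_imp_nondegenerate:
  assumes w: "w \<in> {1..n::nat} \<rightarrow> carrier M"
    and expand: "\<And>x. x \<in> carrier M \<Longrightarrow> x = (\<Oplus>\<^bsub>M\<^esub>r\<in>{1..n}. e r \<triangleleft>\<^bsub>M\<^esub> h (w r) x)"
    and e: "e \<in> {1..n} \<rightarrow> carrier M"
    and x: "x \<in> carrier M" and y: "y \<in> carrier M"
    and eq: "\<And>z. z \<in> carrier M \<Longrightarrow> h z x = h z y"
  shows "x = y"
proof -
  have "(\<Oplus>\<^bsub>M\<^esub>r\<in>{1..n}. e r \<triangleleft>\<^bsub>M\<^esub> h (w r) x) = (\<Oplus>\<^bsub>M\<^esub>r\<in>{1..n}. e r \<triangleleft>\<^bsub>M\<^esub> h (w r) y)"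
    using w e y eq by (intro M.M.finsum_cong') (auto simp: Pi_iff)
  then show ?thesis using expand[OF x] expand[OF y] by simp
qed

text \<open>Surjectivity of \<open>form_hat\<close> represents the functionals of a dual basis by
  vectors \<open>w r\<close>. Conversely, the \<open>h (w r)\<close> are themselves dual basis
  functionals, which gives projectivity; the expansion makes \<open>form_hat\<close> injective, and
  a functional is recovered from its values on the \<open>e r\<close>.\<close>

lemma regular_iff_form_dual_basis:
  assumes gen: "generates A M n e"
  shows "regular_hermitian_module A M h \<longleftrightarrow>
    (\<exists>w \<in> {1..n} \<rightarrow> carrier M. \<forall>x\<in>carrier M. x = (\<Oplus>\<^bsub>M\<^esub>r\<in>{1..n}. e r \<triangleleft>\<^bsub>M\<^esub> h (w r) x))"
    (is "?L \<longleftrightarrow> ?R")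
proof
  assume ?L
  then have proj: "projective A M" and inv: "invertible_form A M h"
    by (auto simp: regular_hermitian_module_def)
  obtain \<theta> where \<theta>: "\<And>r. \<theta> r \<in> rmod_hom A M (self_rmodule A)"
    and expand: "\<And>x. x \<in> carrier M \<Longrightarrow> x = (\<Oplus>\<^bsub>M\<^esub>r\<in>{1..n}. e r \<triangleleft>\<^bsub>M\<^esub> \<theta> r x)"
    using M.generates_projective_imp_dual_basis[OF gen proj] by blast
  have "\<exists>w\<in>carrier M. \<forall>x\<in>carrier M. h w x = \<theta> r x" for r
  proof -
    \<comment> \<open>Members of \<open>rmod_dual\<close> are \<open>undefined\<close> off the
      carrier, so \<open>\<theta> r\<close> must be restricted before it can be matched with a value
      of \<open>form_hat\<close>.\<close>
    have "restrict (\<theta> r) (carrier M) \<in> rmod_dual A M"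
      using \<theta>[of r] by (auto simp: rmod_dual_def rmod_hom_def)
    then obtain w where "w \<in> carrier M" "form_hat M h w = restrict (\<theta> r) (carrier M)"
      using inv unfolding invertible_form_def bij_betw_def by (metis imageE)
    then show ?thesis unfolding form_hat_def by (metis restrict_apply')
  qed
  then obtain w where w: "\<And>r. w r \<in> carrier M" "\<And>r x. x \<in> carrier M \<Longrightarrow> h (w r) x = \<theta> r x"
    by metis
  have "\<forall>x\<in>carrier M. x = (\<Oplus>\<^bsub>M\<^esub>r\<in>{1..n}. e r \<triangleleft>\<^bsub>M\<^esub> h (w r) x)"
    using expand by (simp add: w(2))
  then show ?R using w(1) by blast
next
  assume ?R
  then obtain w where w: "w \<in> {1..n} \<rightarrow> carrier M"
    and expand: "\<And>x. x \<in> carrier M \<Longrightarrow> x = (\<Oplus>\<^bsub>M\<^esub>r\<in>{1..n}. e r \<triangleleft>\<^bsub>M\<^esub> h (w r) x)"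
    by blast
  have e: "e \<in> {1..n} \<rightarrow> carrier M" using gen by (simp add: generates_def)
  have "projective A M"
    by (rule M.dual_basis_imp_projective[OF e _ expand]) (use w form_hom in \<open>auto simp: Pi_iff\<close>)
  moreover have "inj_on (form_hat M h) (carrier M)"
  proof (rule inj_onI)
    fix x y assume x: "x \<in> carrier M" and y: "y \<in> carrier M" and "form_hat M h x = form_hat M h y"
    then have "h x z = h y z" if "z \<in> carrier M" for z
      using that unfolding form_hat_def by (metis restrict_apply')
    \<comment> \<open>Injectivity of \<open>form_hat\<close> concerns the left slot, nondegeneracy
      above the right slot; the star exchanges them.\<close>
    then have "h z x = h z y" if "z \<in> carrier M" for z
      using form_star x y that by metis
    then show "x = y" using form_left_inverse_imp_nondegenerate[OF w expand e x y] by blast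
  qed
  moreover have "form_hat M h ` carrier M = rmod_dual A M"
  proof
    show "form_hat M h ` carrier M \<subseteq> rmod_dual A M"
      by (auto simp: form_hat_def rmod_dual_def rmod_hom_def form_add_right form_ract)
    show "rmod_dual A M \<subseteq> form_hat M h ` carrier M"
    proof
      fix \<phi> assume "\<phi> \<in> rmod_dual A M"
      then have \<phi>: "\<phi> \<in> rmod_hom A M (self_rmodule A)" and ext: "\<phi> \<in> extensional (carrier M)"
        by (auto simp: rmod_dual_def)
      have \<phi>e: "\<phi> (e r) \<in> carrier A" if "r \<in> {1..n}" for r
        using rmod_homD(1)[OF \<phi>] e that by (auto simp: Pi_iff)
      \<comment> \<open>Applying \<open>\<phi>\<close> to the expansion of \<open>y\<close> gives
        the sum of the \<open>\<phi> (e r) \<otimes> h (w r) y\<close>. The coefficients are starred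
        because the left slot of the form stars them again.\<close>
      let ?m = "\<Oplus>\<^bsub>M\<^esub>r\<in>{1..n}. w r \<triangleleft>\<^bsub>M\<^esub> star A (\<phi> (e r))"
      have m: "?m \<in> carrier M" using w \<phi>e by (intro M.M.finsum_closed) auto
      have "h ?m y = \<phi> y" if y: "y \<in> carrier M" for y
      proof -
        have "h ?m y = (\<Oplus>r\<in>{1..n}. star A (star A (\<phi> (e r))) \<otimes> h (w r) y)"
          using w \<phi>e y by (intro form_lin_comb_left) auto
        also have "\<dots> = (\<Oplus>r\<in>{1..n}. \<phi> (e r \<triangleleft>\<^bsub>M\<^esub> h (w r) y))"
          using w e \<phi>e y rmod_homD(3)[OF \<phi>] by (intro A.A.finsum_cong') (auto simp: Pi_iff)
        also have "\<dots> = \<phi> (\<Oplus>\<^bsub>M\<^esub>r\<in>{1..n}. e r \<triangleleft>\<^bsub>M\<^esub> h (w r) y)"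
          using rmod_hom_finsum[OF M.right_module_axioms self_rmodule \<phi>,
              of "{1..n}" "\<lambda>r. e r \<triangleleft>\<^bsub>M\<^esub> h (w r) y"] w e y by (auto simp: Pi_iff)
        also have "\<dots> = \<phi> y" using expand[OF y] by simp
        finally show ?thesis .
      qed
      then have "form_hat M h ?m = \<phi>"
        using ext by (auto simp: form_hat_def extensional_def)
      then show "\<phi> \<in> form_hat M h ` carrier M" by (rule image_eqI[OF sym m])
    qed
  qed
  ultimately show ?L
    using gen right_hermitian_module_axioms
    unfolding regular_hermitian_module_def finitely_generated_def invertible_form_def bij_betw_def
    by blast
qed

text \<open>Exchanging the roles of \<open>e\<close> and \<open>w\<close> is what later lets the
  matrix \<open>h (w r) (w s)\<close> reproduce the functionals \<open>h (w r)\<close>. By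
  nondegeneracy it suffices to pair both sides with an arbitrary \<open>z\<close>.\<close>

lemma form_dual_basis_reversed:
  assumes e: "e \<in> {1..n::nat} \<rightarrow> carrier M" and w: "w \<in> {1..n} \<rightarrow> carrier M"
    and expand: "\<And>x. x \<in> carrier M \<Longrightarrow> x = (\<Oplus>\<^bsub>M\<^esub>r\<in>{1..n}. e r \<triangleleft>\<^bsub>M\<^esub> h (w r) x)"
    and x: "x \<in> carrier M"
  shows "(\<Oplus>\<^bsub>M\<^esub>s\<in>{1..n}. w s \<triangleleft>\<^bsub>M\<^esub> h (e s) x) = x" (is "?y = x")
proof (rule form_left_inverse_imp_nondegenerate[OF w expand e _ x])
  show "?y \<in> carrier M" using e w x by (intro M.M.finsum_closed) auto
  fix z assume z: "z \<in> carrier M"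
  have "h z ?y = (\<Oplus>s\<in>{1..n}. h z (w s) \<otimes> h (e s) x)"
    using e w x z by (intro form_lin_comb_right) auto
  \<comment> \<open>Written with stars, the coefficients are those produced by the expansion of
    \<open>z\<close> in the left slot.\<close>
  also have "\<dots> = (\<Oplus>s\<in>{1..n}. star A (h (w s) z) \<otimes> h (e s) x)"
    using e w x z by (intro A.A.finsum_cong') (auto simp: form_star Pi_iff)
  also have "\<dots> = h (\<Oplus>\<^bsub>M\<^esub>s\<in>{1..n}. e s \<triangleleft>\<^bsub>M\<^esub> h (w s) z) x"
    using e w x z by (intro form_lin_comb_left[symmetric]) auto
  also have "\<dots> = h z x" using expand[OF z] by simp
  finally show "h z ?y = h z x" .
qed

text \<open>Pulling \<open>e r\<close> out of the inner sum turns the double sum into an expansion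
  whose coefficients are functionals of \<open>x\<close>.\<close>

lemma lin_comb_matrix_form:
  assumes e: "e \<in> {1..n::nat} \<rightarrow> carrier M"
    and H: "\<And>r s. r \<in> {1..n} \<Longrightarrow> s \<in> {1..n} \<Longrightarrow> H r s \<in> carrier A" and x: "x \<in> carrier M"
  shows "(\<Oplus>\<^bsub>M\<^esub>r\<in>{1..n}. \<Oplus>\<^bsub>M\<^esub>s\<in>{1..n}. e r \<triangleleft>\<^bsub>M\<^esub> (H r s \<otimes> h (e s) x)) =
    (\<Oplus>\<^bsub>M\<^esub>r\<in>{1..n}. e r \<triangleleft>\<^bsub>M\<^esub> (\<Oplus>s\<in>{1..n}. H r s \<otimes> h (e s) x))"
proof (rule M.M.finsum_cong')
  have val: "(\<lambda>s. H r s \<otimes> h (e s) x) \<in> {1..n} \<rightarrow> carrier A" if "r \<in> {1..n}" for r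
    using e H x that by (auto simp: Pi_iff)
  show "(\<lambda>r. e r \<triangleleft>\<^bsub>M\<^esub> (\<Oplus>s\<in>{1..n}. H r s \<otimes> h (e s) x)) \<in> {1..n} \<rightarrow> carrier M"
    using e A.A.finsum_closed[OF val] by blast
  show "(\<Oplus>\<^bsub>M\<^esub>s\<in>{1..n}. e r \<triangleleft>\<^bsub>M\<^esub> (H r s \<otimes> h (e s) x)) =
      e r \<triangleleft>\<^bsub>M\<^esub> (\<Oplus>s\<in>{1..n}. H r s \<otimes> h (e s) x)" if "r \<in> {1..n}" for r
    using e that by (intro M.ract_finsum[OF _ _ val[OF that], symmetric]) auto
qed simp

end

section \<open>From the vectors \<open>w r\<close> to the hermitian matrix and back\<close>

theorem proposition2p6:
  fixes A :: "'a star_algebra" and M :: "('a, 'm) rmodule" and h :: "'m \<Rightarrow> 'm \<Rightarrow> 'a"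
    and n :: nat and e :: "nat \<Rightarrow> 'm"
  assumes "right_hermitian_module A M h"
    and "generates A M n e"
  shows "regular_hermitian_module A M h \<longleftrightarrow>
    (\<exists>H :: nat \<Rightarrow> nat \<Rightarrow> 'a.
       (\<forall>a\<in>{1..n}. \<forall>b\<in>{1..n}. H a b \<in> carrier A \<and> star A (H a b) = H b a) \<and>
       (\<forall>c\<in>{1..n}.
          (\<Oplus>\<^bsub>M\<^esub>r\<in>{1..n}. \<Oplus>\<^bsub>M\<^esub>s\<in>{1..n}. e r \<triangleleft>\<^bsub>M\<^esub> (H r s \<otimes>\<^bsub>A\<^esub> h (e s) (e c))) = e c))"
proof -
  interpret right_hermitian_module A M h by fact
  have e: "e \<in> {1..n} \<rightarrow> carrier M" using assms(2) by (simp add: generates_def)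
  show ?thesis
    unfolding regular_iff_form_dual_basis[OF assms(2)]
  proof (rule iffI; elim bexE exE conjE)
    fix w assume w: "w \<in> {1..n} \<rightarrow> carrier M"
      and expand: "\<forall>x\<in>carrier M. x = (\<Oplus>\<^bsub>M\<^esub>r\<in>{1..n}. e r \<triangleleft>\<^bsub>M\<^esub> h (w r) x)"
    let ?H = "\<lambda>r s. h (w r) (w s)"
    have H: "?H r s \<in> carrier A" if "r \<in> {1..n}" "s \<in> {1..n}" for r s
      using w that by blast
    have "(\<Oplus>\<^bsub>M\<^esub>r\<in>{1..n}. \<Oplus>\<^bsub>M\<^esub>s\<in>{1..n}. e r \<triangleleft>\<^bsub>M\<^esub> (?H r s \<otimes>\<^bsub>A\<^esub> h (e s) (e c))) = e c"
      if c: "c \<in> {1..n}" for c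
    proof -
      have ec: "e c \<in> carrier M" using e c by blast
      have "(\<Oplus>\<^bsub>A\<^esub>s\<in>{1..n}. ?H r s \<otimes>\<^bsub>A\<^esub> h (e s) (e c)) = h (w r) (e c)" if "r \<in> {1..n}" for r
      proof -
        \<comment> \<open>Linearity of \<open>h (w r)\<close> collects the sum into the reversed
          expansion of \<open>e c\<close>.\<close>
        have "(\<Oplus>\<^bsub>A\<^esub>s\<in>{1..n}. ?H r s \<otimes>\<^bsub>A\<^esub> h (e s) (e c)) =
            h (w r) (\<Oplus>\<^bsub>M\<^esub>s\<in>{1..n}. w s \<triangleleft>\<^bsub>M\<^esub> h (e s) (e c))"
          using e w ec that by (intro form_lin_comb_right[symmetric]) (auto simp: Pi_iff)
        then show ?thesis using form_dual_basis_reversed[OF e w bspec[OF expand] ec] by simp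
      qed
      then have "(\<Oplus>\<^bsub>M\<^esub>r\<in>{1..n}. e r \<triangleleft>\<^bsub>M\<^esub> (\<Oplus>\<^bsub>A\<^esub>s\<in>{1..n}. ?H r s \<otimes>\<^bsub>A\<^esub> h (e s) (e c))) =
          (\<Oplus>\<^bsub>M\<^esub>r\<in>{1..n}. e r \<triangleleft>\<^bsub>M\<^esub> h (w r) (e c))"
        using e w ec by (intro M.M.finsum_cong') (auto simp: Pi_iff)
      then show ?thesis using lin_comb_matrix_form[where H = ?H, OF e H ec] expand ec by simp
    qed
    moreover have "star A (?H r s) = ?H s r" if "r \<in> {1..n}" "s \<in> {1..n}" for r s
      using w that by (intro form_star) (auto simp: Pi_iff)
    ultimately show "\<exists>H. (\<forall>a\<in>{1..n}. \<forall>b\<in>{1..n}. H a b \<in> carrier A \<and> star A (H a b) = H b a) \<and>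
        (\<forall>c\<in>{1..n}. (\<Oplus>\<^bsub>M\<^esub>r\<in>{1..n}. \<Oplus>\<^bsub>M\<^esub>s\<in>{1..n}. e r \<triangleleft>\<^bsub>M\<^esub> (H r s \<otimes>\<^bsub>A\<^esub> h (e s) (e c))) = e c)"
      using H by (intro exI[of _ ?H]) blast
  next
    fix H assume "\<forall>a\<in>{1..n}. \<forall>b\<in>{1..n}. H a b \<in> carrier A \<and> star A (H a b) = H b a"
      and He: "\<forall>c\<in>{1..n}.
        (\<Oplus>\<^bsub>M\<^esub>r\<in>{1..n}. \<Oplus>\<^bsub>M\<^esub>s\<in>{1..n}. e r \<triangleleft>\<^bsub>M\<^esub> (H r s \<otimes>\<^bsub>A\<^esub> h (e s) (e c))) = e c"
    then have H: "H r s \<in> carrier A" if "r \<in> {1..n}" "s \<in> {1..n}" for r s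
      using that by blast
    \<comment> \<open>The stars cancel those from the left slot, so \<open>h (?w r)\<close> has
      exactly the coefficients \<open>H r s\<close> on the \<open>h (e s)\<close>.\<close>
    let ?w = "\<lambda>r. \<Oplus>\<^bsub>M\<^esub>s\<in>{1..n}. e s \<triangleleft>\<^bsub>M\<^esub> star A (H r s)"
    have w: "?w \<in> {1..n} \<rightarrow> carrier M"
      using e H by (intro Pi_I M.M.finsum_closed) (auto simp: Pi_iff)
    have hw: "h (?w r) x = (\<Oplus>\<^bsub>A\<^esub>s\<in>{1..n}. H r s \<otimes>\<^bsub>A\<^esub> h (e s) x)"
      if "r \<in> {1..n}" "x \<in> carrier M" for r x
    proof -
      have "h (?w r) x = (\<Oplus>\<^bsub>A\<^esub>s\<in>{1..n}. star A (star A (H r s)) \<otimes>\<^bsub>A\<^esub> h (e s) x)"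
        using e H that by (intro form_lin_comb_left) (auto simp: Pi_iff)
      also have "\<dots> = (\<Oplus>\<^bsub>A\<^esub>s\<in>{1..n}. H r s \<otimes>\<^bsub>A\<^esub> h (e s) x)"
        using e H that by (intro A.A.finsum_cong') (auto simp: Pi_iff)
      finally show ?thesis .
    qed
    have "(\<Oplus>\<^bsub>M\<^esub>r\<in>{1..n}. e r \<triangleleft>\<^bsub>M\<^esub> h (?w r) x) = x" if x: "x \<in> carrier M" for x
    \<comment> \<open>The matrix identity is given only on the \<open>e c\<close>. Both sides are
      homomorphisms in \<open>x\<close>, so agreement on the generators suffices.\<close>
    proof (rule M.rmod_hom_eq_on_generators[OF assms(2) M.right_module_axioms _ _ _ x])
      show "(\<lambda>x. \<Oplus>\<^bsub>M\<^esub>r\<in>{1..n}. e r \<triangleleft>\<^bsub>M\<^esub> h (?w r) x) \<in> rmod_hom A M M"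
        using w by (intro M.finsum_functionals_hom e form_hom) (auto simp: Pi_iff)
      show "(\<lambda>x. x) \<in> rmod_hom A M M" by (auto simp: rmod_hom_def)
      fix c assume c: "c \<in> {1..n}"
      then have ec: "e c \<in> carrier M" using e by blast
      have "(\<Oplus>\<^bsub>M\<^esub>r\<in>{1..n}. e r \<triangleleft>\<^bsub>M\<^esub> h (?w r) (e c)) =
          (\<Oplus>\<^bsub>M\<^esub>r\<in>{1..n}. e r \<triangleleft>\<^bsub>M\<^esub> (\<Oplus>\<^bsub>A\<^esub>s\<in>{1..n}. H r s \<otimes>\<^bsub>A\<^esub> h (e s) (e c)))"
        using e H ec hw
        by (intro M.M.finsum_cong' refl Pi_I M.ract_closed A.A.finsum_closed) (auto simp: Pi_iff)
      then show "(\<Oplus>\<^bsub>M\<^esub>r\<in>{1..n}. e r \<triangleleft>\<^bsub>M\<^esub> h (?w r) (e c)) = e c"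
        using lin_comb_matrix_form[where H = H, OF e H ec] bspec[OF He c] by simp
    qed
    then show "\<exists>w\<in>{1..n} \<rightarrow> carrier M. \<forall>x\<in>carrier M. x = (\<Oplus>\<^bsub>M\<^esub>r\<in>{1..n}. e r \<triangleleft>\<^bsub>M\<^esub> h (w r) x)"
      using w by (intro bexI[OF _ w]) (auto simp: Pi_iff)
  qed
qed

end
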